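(* Let $\mathsf{PTDF}$ be a puncturable TDF mapping $\{0,1\}^{n(\lambda)}$ to $\{0,1\}^{m(\lambda)}$ and let $\mathsf{UPO}=(\mathsf{UPO.Obf},\mathsf{UPO.Eval})$ be an unclonable puncturable obfuscation for a circuit class containing the circuits $\mathsf{PTDF.Inv}(\mathsf{td},\cdot)$. Define $\mathsf{TDFCP}=(\mathsf{Setup},\mathsf{KG},\mathsf{Eval},\mathsf{Inv})$ by: $\mathsf{Setup}(1^\lambda)=\mathsf{PTDF.KG}(1^\lambda)\to(\mathsf{ek},\mathsf{td})$; $\mathsf{KG}(\mathsf{td})=\mathsf{UPO.Obf}(1^\lambda,\mathsf{PTDF.Inv}(\mathsf{td},\cdot))\to\widehat{\mathsf{td}}$ (a quantum state); $\mathsf{Eval}(\mathsf{ek},x)=\mathsf{PTDF.Eval}(\mathsf{ek},x)$; $\mathsf{Inv}(\widehat{\mathsf{td}},y)=\mathsf{UPO.Eval}(\widehat{\mathsf{td}},y)\to(x,\widehat{\mathsf{td}}')$. Then $\mathsf{TDFCP}$ satisfies almost-all-keys correctness: $$\Pr_{(\mathsf{ek},\mathsf{td})\leftarrow\mathsf{Setup}(1^\lambda),\ \widehat{\mathsf{td}}\leftarrow\mathsf{KG}(\mathsf{td})}\Big[\forall x\in\{0,1\}^{n(\lambda)},\ \Pr[x\leftarrow\mathsf{Inv}(\widehat{\mathsf{td}},\mathsf{Eval}(\mathsf{ek},x))]\ge1-\mathrm{negl}(\lambda)\Big]\ge1-\mathrm{negl}(\lambda).$$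
   Context: Conventions. $\lambda$ is the security parameter, $n,m$ are polynomials, QPT means quantum polynomial time, adversaries are non-uniform QPT, $\mathrm{negl}$ is an unspecified negligible function. Algorithms with quantum output sample a quantum state, and outer probabilities are over this sampling. "$x\leftarrow\mathsf{Inv}(\cdot)$" means that the classical output is $x$. The symbol $\bot$ is encoded as a special element of the output space of circuits. Puncturable TDF. Efficient algorithms $(\mathsf{KG},\mathsf{Eval},\mathsf{Inv},\mathsf{Puncture},\mathsf{PuncInv})$ with $\mathsf{KG}(1^\lambda)\to(\mathsf{ek},\mathsf{td})$; deterministic $\mathsf{Eval}(\mathsf{ek},x)\in\{0,1\}^{m(\lambda)}$ for $x\in\{0,1\}^{n(\lambda)}$; deterministic $\mathsf{Inv}(\mathsf{td},y)$; $\mathsf{Puncture}(\mathsf{td},(y_1,y_2))\to\mathsf{td}_{y_1,y_2}$; deterministic $\mathsf{PuncInv}(\mathsf{td}_{y_1,y_2},y)$, such that: - Almost-all-keys inversion correctness: $\Pr_{(\mathsf{ek},\mathsf{td})\leftarrow\mathsf{KG}(1^\lambda)}[\forall x\in\{0,1\}^{n(\lambda)},\ \mathsf{Inv}(\mathsf{td},\mathsf{Eval}(\mathsf{ek},x))=x]\ge1-\mathrm{negl}(\lambda)$. - Puncturing correctness: for any $y_1,y_2\in\{0,1\}^{m(\lambda)}$, with probability $\ge1-\mathrm{negl}(\lambda)$ over $\mathsf{KG}$ and $\mathsf{Puncture}$, for all $y$: $\mathsf{PuncInv}(\mathsf{td}_{y_1,y_2},y)$ equals $\mathsf{Inv}(\mathsf{td},y)$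 if $y\notin\{y_1,y_2\}$ and $\bot$ otherwise. - One-wayness at punctured points: for every QPT $A$, with $(\mathsf{ek},\mathsf{td})\leftarrow\mathsf{KG}(1^\lambda)$, independent uniform $x_1^*,x_2^*\in\{0,1\}^{n(\lambda)}$, $y_j^*=\mathsf{Eval}(\mathsf{ek},x_j^* )$, $\mathsf{td}^*\leftarrow\mathsf{Puncture}(\mathsf{td},(y_1^*,y_2^* ))$ and $(x_1',x_2')\leftarrow A(\mathsf{ek},\mathsf{td}^*,y_1^*,y_2^* )$, $\Pr[x_1'=x_1^*\lor x_2'=x_2^*]\le\mathrm{negl}(\lambda)$. Unclonable puncturable obfuscation (UPO) for a circuit class $\{\mathcal C_\lambda\}$ of circuits $\{0,1\}^{\ell_{in}}\to\{0,1\}^{\ell_{out}}$. A pair of QPT algorithms $\mathsf{Obf}(1^\lambda,C)\to p$ (a quantum state) and $\mathsf{Eval}(p,x)\to(y,p')$ with - Almost-all-keys correctness: for any $C\in\mathcal C_\lambda$, $\Pr_{p\leftarrow\mathsf{Obf}(1^\lambda,C)}\big[\forall x,\ \Pr_{(y,p')\leftarrow\mathsf{Eval}(p,x)}[y=C(x)]\ge1-\mathrm{negl}(\lambda)\big]\ge1-\mathrm{negl}(\lambda)$, where the negligible functions do not depend on $C$; - $\mathcal D$-UPO security (for a distribution $\mathcal D$ on pairs of inputs): every QPT $(A,B,C')$ wins the following game with probability at most $\frac12+\mathrm{negl}(\lambda)$: $A$ sends $C\in\mathcal C_\lambda$; the challenger samples $b\leftarrow\{0,1\}$, $(x_B,x_C)\leftarrow\mathcal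 D$ and sends $A$ an obfuscation of $C$ if $b=0$, or of the circuit that equals $C$ outside $\{x_B,x_C\}$ and outputs $\bot$ on $\{x_B,x_C\}$ if $b=1$; $A$ prepares a bipartite state and sends one register to $B$ and the other to $C'$; $B$ receives $x_B$, $C'$ receives $x_C$; they output bits $b_B,b_C$ without communicating; they win iff $b=b_B=b_C$. *)

theory Defs
  imports
    "HOL-Probability.Probability_Mass_Function"
    "HOL-Library.Landau_Symbols"
    "HOL-Computational_Algebra.Polynomial"
    "Jordan_Normal_Form.Schur_Decomposition"
begin

text \<open>
  The security parameter is written \<open>k\<close>; it is handed to algorithms in unary.
\<close>

section \<open>Asymptotics\<close>

definition negligible :: "(nat \<Rightarrow> real) \<Rightarrow> bool" where
  "negligible \<nu> \<longleftrightarrow> (\<forall>c::nat. \<nu> \<in> O(\<lambda>k. 1 / real k ^ c))"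

definition polynomial :: "(nat \<Rightarrow> nat) \<Rightarrow> bool" where
  "polynomial f \<longleftrightarrow> (\<exists>p :: real poly. \<forall>k. real (f k) = poly p (real k))"

definition poly_bounded :: "(nat \<Rightarrow> nat) \<Rightarrow> bool" where
  "poly_bounded f \<longleftrightarrow> (\<exists>p :: nat poly. \<forall>k. f k \<le> poly p k)"

section \<open>Classical polynomial time\<close>

type_synonym bits = "bool list"

definition unary :: "nat \<Rightarrow> bits" where
  "unary i = replicate i True"

text \<open>Injective serialisation of a list of bit strings (each bit is preceded by a marker
  \<open>True\<close>, each string is terminated by \<open>False\<close>).\<close>

definition pack :: "bits list \<Rightarrow> bits" where
  "pack ws = concat (map (\<lambda>w. concat (map (\<lambda>b. [True, b]) w) @ [False]) ws)"

text \<open>Deterministic Turing machines with one two-way infinite tape. State 0 is initial and state 1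
  is halting; symbol 0 is the blank, symbols 1 and 2 are the bits.\<close>

record tm =
  tm_states :: nat
  tm_syms :: nat
  tm_delta :: "nat \<Rightarrow> nat \<Rightarrow> nat \<times> nat \<times> int"

definition wf_tm :: "tm \<Rightarrow> bool" where
  "wf_tm M \<longleftrightarrow> tm_states M \<ge> 2 \<and> tm_syms M \<ge> 3 \<and>
    (\<forall>q < tm_states M. \<forall>a < tm_syms M. case tm_delta M q a of (q', a', d) \<Rightarrow>
       q' < tm_states M \<and> a' < tm_syms M \<and> d \<in> {-1, 0, 1})"

type_synonym tm_config = "nat \<times> (int \<Rightarrow> nat) \<times> int"

definition tm_step :: "tm \<Rightarrow> tm_config \<Rightarrow> tm_config" where
  "tm_step M = (\<lambda>(q, t, h). if q = 1 then (q, t, h)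
     else case tm_delta M q (t h) of (q', a, d) \<Rightarrow> (q', t(h := a), h + d))"

definition tape :: "bits \<Rightarrow> int \<Rightarrow> nat" where
  "tape w i = (if 0 \<le> i \<and> i < int (length w) then (if w ! nat i then 2 else 1) else 0)"

definition polytime :: "(bits list \<Rightarrow> bits list) \<Rightarrow> bool" where
  "polytime f \<longleftrightarrow> (\<exists>M (p :: nat poly). wf_tm M \<and>
     (\<forall>ws. \<exists>h. (tm_step M ^^ poly p (length (pack ws))) (0, tape (pack ws), 0)
             = (1, tape (pack (f ws)), h)))"

definition uniform_bits :: "nat \<Rightarrow> bits pmf" where
  "uniform_bits l = pmf_of_set {w. length w = l}"

text \<open>Probabilistic polynomial time: a polynomial-time function of the input and of polynomially
  many uniform coins.\<close>

definition ppt :: "(bits list \<Rightarrow> bits list pmf) \<Rightarrow> bool" where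
  "ppt F \<longleftrightarrow> (\<exists>f (r :: nat poly). polytime f \<and>
     (\<forall>ws. F ws = map_pmf (\<lambda>coins. f (coins # ws)) (uniform_bits (poly r (length (pack ws))))))"

section \<open>Boolean circuits\<close>

datatype gate = GConst bool | GNot nat | GAnd nat nat | GOr nat nat

text \<open>Wires are numbered: first the inputs, then the gates in order.\<close>

record circuit =
  c_in :: nat
  c_gates :: "gate list"
  c_outs :: "nat list"

fun gate_val :: "gate \<Rightarrow> bits \<Rightarrow> bool" where
  "gate_val (GConst b) v = b"
| "gate_val (GNot i) v = (\<not> v ! i)"
| "gate_val (GAnd i j) v = (v ! i \<and> v ! j)"
| "gate_val (GOr i j) v = (v ! i \<or> v ! j)"

definition circ_eval :: "circuit \<Rightarrow> bits \<Rightarrow> bits" where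
  "circ_eval C x = (let v = fold (\<lambda>g v. v @ [gate_val g v]) (c_gates C) x
                    in map (\<lambda>i. v ! i) (c_outs C))"

fun gate_wires :: "gate \<Rightarrow> nat set" where
  "gate_wires (GConst b) = {}"
| "gate_wires (GNot i) = {i}"
| "gate_wires (GAnd i j) = {i, j}"
| "gate_wires (GOr i j) = {i, j}"

definition circuits :: "nat \<Rightarrow> nat \<Rightarrow> circuit set" where
  "circuits l_in l_out = {C. c_in C = l_in \<and> length (c_outs C) = l_out \<and>
     (\<forall>i < length (c_gates C). \<forall>j \<in> gate_wires (c_gates C ! i). j < l_in + i) \<and>
     (\<forall>j \<in> set (c_outs C). j < l_in + length (c_gates C))}"

fun enc_gate :: "gate \<Rightarrow> bits list" where
  "enc_gate (GConst b) = [[False, False], [b], []]"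
| "enc_gate (GNot i) = [[False, True], unary i, []]"
| "enc_gate (GAnd i j) = [[True, False], unary i, unary j]"
| "enc_gate (GOr i j) = [[True, True], unary i, unary j]"

definition enc_circ :: "circuit \<Rightarrow> bits" where
  "enc_circ C = pack (unary (c_in C) # unary (length (c_gates C)) #
     concat (map enc_gate (c_gates C)) @ map unary (c_outs C))"

text \<open>Encoding of \<open>{0,1}\<^sup>l \<union> {\<bottom>}\<close> into circuit outputs of length \<open>l + 1\<close>.\<close>

fun enc_opt :: "nat \<Rightarrow> bits option \<Rightarrow> bits" where
  "enc_opt l None = replicate (Suc l) False"
| "enc_opt l (Some x) = True # x"

section \<open>Quantum algorithms\<close>

text \<open>A state of \<open>w\<close> qubits is a density matrix of dimension \<open>2 ^ w\<close>; in a basis index \<open>r\<close>, the value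
  of qubit \<open>i\<close> is \<open>bit r i\<close>. The order on complex numbers used here makes \<open>0 \<le> z\<close> imply that
  \<open>z\<close> is real, so hermiticity is included.\<close>

type_synonym qstate = "complex mat"

definition density :: "nat \<Rightarrow> qstate \<Rightarrow> bool" where
  "density w \<rho> \<longleftrightarrow> \<rho> \<in> carrier_mat (2 ^ w) (2 ^ w) \<and>
     (\<forall>v \<in> carrier_vec (2 ^ w). 0 \<le> (\<rho> *\<^sub>v v) \<bullet>c v) \<and> (\<Sum>i < 2 ^ w. \<rho> $$ (i, i)) = 1"

definition num_qubits :: "qstate \<Rightarrow> nat" where
  "num_qubits \<rho> = (LEAST w. dim_row \<rho> \<le> 2 ^ w)"

definition empty_state :: qstate where
  "empty_state = 1\<^sub>m 1"

text \<open>The qubits of the first factor come first (low-order index bits).\<close>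

definition tensor :: "qstate \<Rightarrow> qstate \<Rightarrow> qstate" where
  "tensor \<rho> \<sigma> = (let d = dim_row \<rho>; e = dim_row \<sigma> in mat (d * e) (d * e)
     (\<lambda>(r, c). \<rho> $$ (r mod d, c mod d) * \<sigma> $$ (r div d, c div d)))"

definition zero_state :: "nat \<Rightarrow> qstate" where
  "zero_state w = mat (2 ^ w) (2 ^ w) (\<lambda>(r, c). if r = 0 \<and> c = 0 then 1 else 0)"

text \<open>Clifford+T gates (a universal set) and computational-basis measurements.\<close>

datatype instr = Had nat | TGate nat | Cnot nat nat | Meas nat

fun gate_mat :: "nat \<Rightarrow> instr \<Rightarrow> complex mat" where
  "gate_mat w (Had i) = mat (2 ^ w) (2 ^ w) (\<lambda>(r, c).
     if unset_bit i r = unset_bit i c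
     then (if bit r i \<and> bit c i then - 1 else 1) / complex_of_real (sqrt 2) else 0)"
| "gate_mat w (TGate i) = mat (2 ^ w) (2 ^ w) (\<lambda>(r, c).
     if r = c then (if bit r i then cis (pi / 4) else 1) else 0)"
| "gate_mat w (Cnot i j) = mat (2 ^ w) (2 ^ w) (\<lambda>(r, c).
     if r = (if bit c i then flip_bit j c else c) then 1 else 0)"
| "gate_mat w (Meas i) = 1\<^sub>m (2 ^ w)"

text \<open>A measurement yields a random bit and the normalised post-measurement state.\<close>

definition prob_bit :: "nat \<Rightarrow> bool \<Rightarrow> qstate \<Rightarrow> real" where
  "prob_bit i b \<rho> = Re (\<Sum>r \<in> {r. r < dim_row \<rho> \<and> bit r i = b}. \<rho> $$ (r, r))"

definition collapse :: "nat \<Rightarrow> bool \<Rightarrow> qstate \<Rightarrow> qstate" where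
  "collapse i b \<rho> = mat (dim_row \<rho>) (dim_col \<rho>) (\<lambda>(r, c).
     if bit r i = b \<and> bit c i = b then \<rho> $$ (r, c) / complex_of_real (prob_bit i b \<rho>) else 0)"

definition measure_qubit :: "nat \<Rightarrow> qstate \<Rightarrow> (bool \<times> qstate) pmf" where
  "measure_qubit i \<rho> =
     map_pmf (\<lambda>b. (b, collapse i b \<rho>)) (bernoulli_pmf (prob_bit i True \<rho>))"

fun measure_qubits :: "nat list \<Rightarrow> qstate \<Rightarrow> (bits \<times> qstate) pmf" where
  "measure_qubits [] \<rho> = return_pmf ([], \<rho>)"
| "measure_qubits (i # is) \<rho> = do {
     (b, \<rho>') \<leftarrow> measure_qubit i \<rho>;
     (bs, \<rho>'') \<leftarrow> measure_qubits is \<rho>';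
     return_pmf (b # bs, \<rho>'')
   }"

fun run_instr :: "nat \<Rightarrow> instr \<Rightarrow> qstate \<Rightarrow> qstate pmf" where
  "run_instr w (Meas i) \<rho> = map_pmf snd (measure_qubit i \<rho>)"
| "run_instr w g \<rho> = return_pmf (gate_mat w g * \<rho> * mat_adjoint (gate_mat w g))"

fun run_instrs :: "nat \<Rightarrow> instr list \<Rightarrow> qstate \<Rightarrow> qstate pmf" where
  "run_instrs w [] \<rho> = return_pmf \<rho>"
| "run_instrs w (g # gs) \<rho> = run_instr w g \<rho> \<bind> run_instrs w gs"

text \<open>Reduced state on the qubits \<open>qs\<close> (in that order): partial trace over the others.\<close>

definition reduced :: "nat \<Rightarrow> nat list \<Rightarrow> qstate \<Rightarrow> qstate" where
  "reduced w qs \<rho> = (let sub = (\<lambda>a :: nat. horner_sum of_bool 2 (map (bit a) qs)) in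
     mat (2 ^ length qs) (2 ^ length qs) (\<lambda>(r, c).
       \<Sum>(a, b) \<in> {(a, b). a < 2 ^ w \<and> b < 2 ^ w \<and> sub a = r \<and> sub b = c \<and>
                        (\<forall>i < w. i \<notin> set qs \<longrightarrow> bit a i = bit b i)}. \<rho> $$ (a, b)))"

text \<open>A quantum program acts on \<open>qp_width\<close> qubits, the first ones holding the quantum input and the
  rest initialised to zero. At the end the qubits \<open>qp_cout\<close> are measured (classical output); the
  quantum output consists of the qubits \<open>qp_qout\<close>.\<close>

record qprog =
  qp_width :: nat
  qp_instrs :: "instr list"
  qp_cout :: "nat list"
  qp_qout :: "nat list"

fun wf_instr :: "nat \<Rightarrow> instr \<Rightarrow> bool" where
  "wf_instr w (Cnot i j) = (i < w \<and> j < w \<and> i \<noteq> j)"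
| "wf_instr w (Had i) = (i < w)"
| "wf_instr w (TGate i) = (i < w)"
| "wf_instr w (Meas i) = (i < w)"

definition wf_qprog :: "nat \<Rightarrow> qprog \<Rightarrow> bool" where
  "wf_qprog q P \<longleftrightarrow> q \<le> qp_width P \<and> (\<forall>g \<in> set (qp_instrs P). wf_instr (qp_width P) g) \<and>
     (\<forall>i \<in> set (qp_cout P) \<union> set (qp_qout P). i < qp_width P) \<and> distinct (qp_qout P)"

definition run_qprog :: "qprog \<Rightarrow> qstate \<Rightarrow> (bits \<times> qstate) pmf" where
  "run_qprog P \<rho> = do {
     let w = qp_width P;
     \<sigma> \<leftarrow> run_instrs w (qp_instrs P) (tensor \<rho> (zero_state (w - num_qubits \<rho>)));
     (y, \<tau>) \<leftarrow> measure_qubits (qp_cout P) \<sigma>;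
     return_pmf (y, reduced w (qp_qout P) \<tau>)
   }"

fun enc_instr :: "instr \<Rightarrow> bits list" where
  "enc_instr (Had i) = [[False, False], unary i, []]"
| "enc_instr (TGate i) = [[False, True], unary i, []]"
| "enc_instr (Cnot i j) = [[True, False], unary i, unary j]"
| "enc_instr (Meas i) = [[True, True], unary i, []]"

definition enc_qprog :: "qprog \<Rightarrow> bits list" where
  "enc_qprog P = unary (qp_width P) # unary (length (qp_instrs P)) # unary (length (qp_cout P)) #
     concat (map enc_instr (qp_instrs P)) @ map unary (qp_cout P) @ map unary (qp_qout P)"

text \<open>A quantum algorithm maps its classical inputs, preceded by the number of qubits of its quantum
  input in unary, to the program to be run on that quantum input. It is QPT if a
  polynomial-time Turing machine writes down this program. The sampled output state is the
  one conditioned on all measurement outcomes that occurred during the run.\<close>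

type_synonym qalg = "bits list \<Rightarrow> qprog"

definition qpt :: "qalg \<Rightarrow> bool" where
  "qpt A \<longleftrightarrow> polytime (\<lambda>ws. enc_qprog (A ws)) \<and> (\<forall>q ws. wf_qprog q (A (unary q # ws)))"

definition run_qalg :: "qalg \<Rightarrow> bits list \<Rightarrow> qstate \<Rightarrow> (bits \<times> qstate) pmf" where
  "run_qalg A ws \<rho> = run_qprog (A (unary (num_qubits \<rho>) # ws)) \<rho>"

text \<open>Two programs acting without communication on the two registers of a bipartite state, the first
  \<open>q\<close> qubits of \<open>\<tau>\<close> being the register of the first program. The joint layout is: first
  register, second register, ancillas of the first program, ancillas of the second program.\<close>

fun rename_instr :: "(nat \<Rightarrow> nat) \<Rightarrow> instr \<Rightarrow> instr" where
  "rename_instr f (Had i) = Had (f i)"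
| "rename_instr f (TGate i) = TGate (f i)"
| "rename_instr f (Cnot i j) = Cnot (f i) (f j)"
| "rename_instr f (Meas i) = Meas (f i)"

definition run_separately :: "nat \<Rightarrow> qprog \<Rightarrow> qprog \<Rightarrow> qstate \<Rightarrow> (bits \<times> bits) pmf" where
  "run_separately q P Q \<tau> = do {
     let q' = num_qubits \<tau> - q;
     let w = qp_width P + qp_width Q;
     let f = (\<lambda>j. if j < q then j else j + q');
     let g = (\<lambda>j. if j < q' then j + q else j + qp_width P);
     \<sigma> \<leftarrow> run_instrs w (map (rename_instr f) (qp_instrs P) @ map (rename_instr g) (qp_instrs Q))
           (tensor \<tau> (zero_state (w - num_qubits \<tau>)));
     (y, \<sigma>') \<leftarrow> measure_qubits (map f (qp_cout P)) \<sigma>;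
     (z, \<sigma>'') \<leftarrow> measure_qubits (map g (qp_cout Q)) \<sigma>';
     return_pmf (y, z)
   }"

text \<open>Polynomial-size classical and quantum advice for non-uniform adversaries.\<close>

definition poly_advice :: "(nat \<Rightarrow> bits) \<Rightarrow> (nat \<Rightarrow> qstate) \<Rightarrow> bool" where
  "poly_advice a \<rho> \<longleftrightarrow> poly_bounded (\<lambda>k. length (a k)) \<and>
     (\<exists>q. poly_bounded q \<and> (\<forall>k. density (q k) (\<rho> k)))"

section \<open>Puncturable trapdoor functions\<close>

text \<open>The value \<open>None\<close> of the inversion algorithms is \<open>\<bottom>\<close>.\<close>

record ptdf =
  kg :: "nat \<Rightarrow> (bits \<times> bits) pmf"
  tdf_eval :: "nat \<Rightarrow> bits \<Rightarrow> bits \<Rightarrow> bits"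
  tdf_inv :: "nat \<Rightarrow> bits \<Rightarrow> bits \<Rightarrow> bits option"
  punct :: "nat \<Rightarrow> bits \<Rightarrow> bits \<times> bits \<Rightarrow> bits pmf"
  punct_inv :: "nat \<Rightarrow> bits \<Rightarrow> bits \<Rightarrow> bits option"

definition ptdf_syntax :: "(nat \<Rightarrow> nat) \<Rightarrow> (nat \<Rightarrow> nat) \<Rightarrow> ptdf \<Rightarrow> bool" where
  "ptdf_syntax n m T \<longleftrightarrow>
     (\<forall>k. \<forall>(ek, td) \<in> set_pmf (kg T k).
        (\<forall>x. length x = n k \<longrightarrow> length (tdf_eval T k ek x) = m k) \<and>
        (\<forall>y x. length y = m k \<longrightarrow> tdf_inv T k td y = Some x \<longrightarrow> length x = n k))"

definition ptdf_efficient :: "(nat \<Rightarrow> nat) \<Rightarrow> ptdf \<Rightarrow> bool" where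
  "ptdf_efficient n T \<longleftrightarrow>
     (\<exists>F. ppt F \<and> (\<forall>k. F [unary k] = map_pmf (\<lambda>(ek, td). [ek, td]) (kg T k))) \<and>
     (\<exists>f. polytime f \<and> (\<forall>k ek x. f [unary k, ek, x] = [tdf_eval T k ek x])) \<and>
     (\<exists>f. polytime f \<and> (\<forall>k td y. f [unary k, td, y] = [enc_opt (n k) (tdf_inv T k td y)])) \<and>
     (\<exists>F. ppt F \<and> (\<forall>k td y1 y2.
        F [unary k, td, y1, y2] = map_pmf (\<lambda>td'. [td']) (punct T k td (y1, y2)))) \<and>
     (\<exists>f. polytime f \<and> (\<forall>k td' y. f [unary k, td', y] = [enc_opt (n k) (punct_inv T k td' y)]))"

definition inversion_correct :: "(nat \<Rightarrow> nat) \<Rightarrow> ptdf \<Rightarrow> bool" where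
  "inversion_correct n T \<longleftrightarrow> (\<exists>\<nu>. negligible \<nu> \<and> (\<forall>k.
     measure_pmf.prob (kg T k)
       {(ek, td). \<forall>x. length x = n k \<longrightarrow> tdf_inv T k td (tdf_eval T k ek x) = Some x} \<ge> 1 - \<nu> k))"

definition puncturing_correct :: "(nat \<Rightarrow> nat) \<Rightarrow> ptdf \<Rightarrow> bool" where
  "puncturing_correct m T \<longleftrightarrow> (\<exists>\<nu>. negligible \<nu> \<and>
     (\<forall>k y1 y2. length y1 = m k \<longrightarrow> length y2 = m k \<longrightarrow>
       measure_pmf.prob
         (do { (ek, td) \<leftarrow> kg T k; td' \<leftarrow> punct T k td (y1, y2); return_pmf (td, td') })
         {(td, td'). \<forall>y. length y = m k \<longrightarrow>
            punct_inv T k td' y = (if y \<in> {y1, y2} then None else tdf_inv T k td y)} \<ge> 1 - \<nu> k))"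

text \<open>The adversary's pair of guesses is the two halves of its classical output.\<close>

definition ow_game ::
    "(nat \<Rightarrow> nat) \<Rightarrow> ptdf \<Rightarrow> qalg \<Rightarrow> (nat \<Rightarrow> bits) \<Rightarrow> (nat \<Rightarrow> qstate) \<Rightarrow> nat \<Rightarrow> bool pmf" where
  "ow_game n T A a \<rho> k = do {
     (ek, td) \<leftarrow> kg T k;
     x1 \<leftarrow> uniform_bits (n k);
     x2 \<leftarrow> uniform_bits (n k);
     let y1 = tdf_eval T k ek x1;
     let y2 = tdf_eval T k ek x2;
     td' \<leftarrow> punct T k td (y1, y2);
     (z, _) \<leftarrow> run_qalg A [unary k, a k, ek, td', y1, y2] (\<rho> k);
     return_pmf (take (n k) z = x1 \<or> drop (n k) z = x2)
   }"

definition one_way_at_punctured :: "(nat \<Rightarrow> nat) \<Rightarrow> ptdf \<Rightarrow> bool" where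
  "one_way_at_punctured n T \<longleftrightarrow> (\<forall>A a \<rho>. qpt A \<longrightarrow> poly_advice a \<rho> \<longrightarrow>
     (\<exists>\<nu>. negligible \<nu> \<and> (\<forall>k. pmf (ow_game n T A a \<rho> k) True \<le> \<nu> k)))"

definition puncturable_tdf :: "(nat \<Rightarrow> nat) \<Rightarrow> (nat \<Rightarrow> nat) \<Rightarrow> ptdf \<Rightarrow> bool" where
  "puncturable_tdf n m T \<longleftrightarrow> polynomial n \<and> polynomial m \<and>
     ptdf_syntax n m T \<and> ptdf_efficient n T \<and>
     inversion_correct n T \<and> puncturing_correct m T \<and> one_way_at_punctured n T"

text \<open>\<open>I k td\<close> is a circuit for the inversion algorithm with hardwired trapdoor; it is efficiently
  computable from the trapdoor.\<close>

definition inversion_circuits ::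
    "(nat \<Rightarrow> nat) \<Rightarrow> (nat \<Rightarrow> nat) \<Rightarrow> ptdf \<Rightarrow> (nat \<Rightarrow> bits \<Rightarrow> circuit) \<Rightarrow> bool" where
  "inversion_circuits n m T I \<longleftrightarrow>
     (\<exists>f. polytime f \<and> (\<forall>k td. f [unary k, td] = [enc_circ (I k td)])) \<and>
     (\<forall>k. \<forall>(ek, td) \<in> set_pmf (kg T k). I k td \<in> circuits (m k) (Suc (n k)) \<and>
        (\<forall>y. length y = m k \<longrightarrow> circ_eval (I k td) y = enc_opt (n k) (tdf_inv T k td y)))"

section \<open>Unclonable puncturable obfuscation\<close>

record upo =
  obf_alg :: qalg
  eval_alg :: qalg

definition obf :: "upo \<Rightarrow> nat \<Rightarrow> circuit \<Rightarrow> qstate pmf" where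
  "obf U k C = map_pmf snd (run_qalg (obf_alg U) [unary k, enc_circ C] empty_state)"

definition upo_eval :: "upo \<Rightarrow> nat \<Rightarrow> qstate \<Rightarrow> bits \<Rightarrow> (bits \<times> qstate) pmf" where
  "upo_eval U k p x = run_qalg (eval_alg U) [unary k, x] p"

definition upo_correct :: "(nat \<Rightarrow> nat) \<Rightarrow> (nat \<Rightarrow> circuit set) \<Rightarrow> upo \<Rightarrow> bool" where
  "upo_correct l_in \<C> U \<longleftrightarrow> (\<exists>\<nu> \<nu>'. negligible \<nu> \<and> negligible \<nu>' \<and> (\<forall>k. \<forall>C \<in> \<C> k.
     measure_pmf.prob (obf U k C)
       {p. \<forall>x. length x = l_in k \<longrightarrow>
          measure_pmf.prob (upo_eval U k p x) {(y, p'). y = circ_eval C x} \<ge> 1 - \<nu> k} \<ge> 1 - \<nu>' k))"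

text \<open>\<open>pc k C x x'\<close> is the circuit that equals \<open>C\<close> except that it outputs \<open>\<bottom>\<close> on \<open>x\<close> and \<open>x'\<close>.\<close>

definition punctured_circuits ::
    "(nat \<Rightarrow> nat) \<Rightarrow> (nat \<Rightarrow> nat) \<Rightarrow> (nat \<Rightarrow> bits) \<Rightarrow> (nat \<Rightarrow> circuit set) \<Rightarrow>
     (nat \<Rightarrow> circuit \<Rightarrow> bits \<Rightarrow> bits \<Rightarrow> circuit) \<Rightarrow> bool" where
  "punctured_circuits l_in l_out bt \<C> pc \<longleftrightarrow>
     (\<exists>f. polytime f \<and> (\<forall>k C x x'. f [unary k, enc_circ C, x, x'] = [enc_circ (pc k C x x')])) \<and>
     (\<forall>k. \<forall>C \<in> \<C> k. \<forall>x x'. length x = l_in k \<longrightarrow> length x' = l_in k \<longrightarrow>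
        pc k C x x' \<in> circuits (l_in k) (l_out k) \<and>
        (\<forall>z. length z = l_in k \<longrightarrow>
           circ_eval (pc k C x x') z = (if z \<in> {x, x'} then bt k else circ_eval C z)))"

text \<open>An adversary: the two stages of \<open>A\<close> (choice of the circuit; preparation of the bipartite
  state), the number of qubits of the register sent to \<open>B\<close>, the two second-phase
  players, and non-uniform advice. Quantum advice for the latter two can be routed through \<open>A\<close>.\<close>

record upo_adv =
  adv_A1 :: qalg
  adv_A2 :: qalg
  adv_split :: "nat \<Rightarrow> nat"
  adv_B :: qalg
  adv_C :: qalg
  adv_advice :: "nat \<Rightarrow> bits"
  adv_qadvice :: "nat \<Rightarrow> qstate"

definition qpt_upo_adv :: "upo_adv \<Rightarrow> bool" where
  "qpt_upo_adv \<A> \<longleftrightarrow> qpt (adv_A1 \<A>) \<and> qpt (adv_A2 \<A>) \<and> qpt (adv_B \<A>) \<and> qpt (adv_C \<A>) \<and>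
     poly_advice (adv_advice \<A>) (adv_qadvice \<A>)"

text \<open>An adversary whose first message does not describe a circuit of the class loses.\<close>

definition upo_game ::
    "(nat \<Rightarrow> (bits \<times> bits) pmf) \<Rightarrow> (nat \<Rightarrow> circuit set) \<Rightarrow>
     (nat \<Rightarrow> circuit \<Rightarrow> bits \<Rightarrow> bits \<Rightarrow> circuit) \<Rightarrow> upo \<Rightarrow> upo_adv \<Rightarrow> nat \<Rightarrow> bool pmf" where
  "upo_game D \<C> pc U \<A> k = do {
     let a = adv_advice \<A> k;
     (msg, \<sigma>) \<leftarrow> run_qalg (adv_A1 \<A>) [unary k, a] (adv_qadvice \<A> k);
     if msg \<notin> enc_circ ` \<C> k then return_pmf False else do {
       let C = (THE C. C \<in> \<C> k \<and> enc_circ C = msg);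
       b \<leftarrow> bernoulli_pmf (1 / 2);
       (xB, xC) \<leftarrow> D k;
       p \<leftarrow> obf U k (if b then pc k C xB xC else C);
       (_, \<tau>) \<leftarrow> run_qalg (adv_A2 \<A>) [unary k, a, msg] (tensor p \<sigma>);
       let qB = min (adv_split \<A> k) (num_qubits \<tau>);
       let qC = num_qubits \<tau> - qB;
       (bB, bC) \<leftarrow> run_separately qB (adv_B \<A> [unary qB, unary k, a, xB])
                                    (adv_C \<A> [unary qC, unary k, a, xC]) \<tau>;
       return_pmf (bB = [b] \<and> bC = [b])
     }
   }"

definition upo_secure ::
    "(nat \<Rightarrow> (bits \<times> bits) pmf) \<Rightarrow> (nat \<Rightarrow> circuit set) \<Rightarrow>
     (nat \<Rightarrow> circuit \<Rightarrow> bits \<Rightarrow> bits \<Rightarrow> circuit) \<Rightarrow> upo \<Rightarrow> bool" where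
  "upo_secure D \<C> pc U \<longleftrightarrow> (\<forall>\<A>. qpt_upo_adv \<A> \<longrightarrow>
     (\<exists>\<nu>. negligible \<nu> \<and> (\<forall>k. pmf (upo_game D \<C> pc U \<A> k) True \<le> 1 / 2 + \<nu> k)))"

definition unclonable_puncturable_obf ::
    "(nat \<Rightarrow> nat) \<Rightarrow> (nat \<Rightarrow> nat) \<Rightarrow> (nat \<Rightarrow> bits) \<Rightarrow> (nat \<Rightarrow> (bits \<times> bits) pmf) \<Rightarrow>
     (nat \<Rightarrow> circuit set) \<Rightarrow> (nat \<Rightarrow> circuit \<Rightarrow> bits \<Rightarrow> bits \<Rightarrow> circuit) \<Rightarrow> upo \<Rightarrow> bool" where
  "unclonable_puncturable_obf l_in l_out bt D \<C> pc U \<longleftrightarrow>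
     (\<forall>k. \<C> k \<subseteq> circuits (l_in k) (l_out k)) \<and>
     (\<forall>k. length (bt k) = l_out k) \<and>
     (\<forall>k. \<forall>(x, x') \<in> set_pmf (D k). length x = l_in k \<and> length x' = l_in k) \<and>
     punctured_circuits l_in l_out bt \<C> pc \<and>
     qpt (obf_alg U) \<and> qpt (eval_alg U) \<and>
     upo_correct l_in \<C> U \<and> upo_secure D \<C> pc U"

section \<open>The copy-protected trapdoor function\<close>

record tdfcp =
  cp_setup :: "nat \<Rightarrow> (bits \<times> bits) pmf"
  cp_kg :: "nat \<Rightarrow> bits \<Rightarrow> qstate pmf"
  cp_eval :: "nat \<Rightarrow> bits \<Rightarrow> bits \<Rightarrow> bits"
  cp_inv :: "nat \<Rightarrow> qstate \<Rightarrow> bits \<Rightarrow> (bits \<times> qstate) pmf"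

definition TDFCP :: "ptdf \<Rightarrow> (nat \<Rightarrow> bits \<Rightarrow> circuit) \<Rightarrow> upo \<Rightarrow> tdfcp" where
  "TDFCP T I U = \<lparr>
     cp_setup = kg T,
     cp_kg = (\<lambda>k td. obf U k (I k td)),
     cp_eval = tdf_eval T,
     cp_inv = upo_eval U \<rparr>"

text \<open>The classical output of inversion is a circuit output, in which a preimage \<open>x\<close> appears in its
  encoded form \<open>enc_opt (n k) (Some x)\<close>.\<close>

definition almost_all_keys_correct :: "(nat \<Rightarrow> nat) \<Rightarrow> tdfcp \<Rightarrow> bool" where
  "almost_all_keys_correct n S \<longleftrightarrow> (\<exists>\<nu> \<nu>'. negligible \<nu> \<and> negligible \<nu>' \<and> (\<forall>k.
     measure_pmf.prob
       (do { (ek, td) \<leftarrow> cp_setup S k; tdh \<leftarrow> cp_kg S k td; return_pmf (ek, tdh) })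
       {(ek, tdh). \<forall>x. length x = n k \<longrightarrow>
          measure_pmf.prob (cp_inv S k tdh (cp_eval S k ek x))
            {(z, tdh'). z = enc_opt (n k) (Some x)} \<ge> 1 - \<nu> k} \<ge> 1 - \<nu>' k))"

end

theory Submission
  imports Defs
begin

text \<open>Union bound over two bad events: that the trapdoor does not invert \<open>tdf_eval\<close>, and that the
  obfuscation of its inversion circuit is faulty. Outside both, evaluating the obfuscated circuit at the
  image of \<open>x\<close> gives \<open>x\<close>. Since the obfuscator's bound is uniform over the circuit class, it holds
  conditionally on every key pair.\<close>

lemma negligible_add:
  assumes "negligible f" "negligible g"
  shows "negligible (\<lambda>k. f k + g k)"
  using assms unfolding negligible_def by (auto intro: sum_in_bigo)

text \<open>The probability after the bind is the average of the conditional probabilities over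
  \<open>M\<close>. The bound \<open>c\<close> may be negative, as \<open>1 - \<nu> k\<close> can
  be: \<open>ennreal\<close> then truncates it to 0, and comparing with a nonnegative probability
  still gives the real inequality.\<close>

lemma prob_bind_pmf_ge:
  assumes "\<And>a. a \<in> set_pmf M \<Longrightarrow> c \<le> measure_pmf.prob (N a) S"
  shows "c \<le> measure_pmf.prob (M \<bind> N) S"
proof -
  have "ennreal c = (\<integral>\<^sup>+a. ennreal c \<partial>measure_pmf M)"
    by (simp add: measure_pmf.emeasure_space_1)
  also have "\<dots> \<le> (\<integral>\<^sup>+a. emeasure (measure_pmf (N a)) S \<partial>measure_pmf M)"
    by (rule nn_integral_mono_AE)
      (simp add: AE_measure_pmf_iff measure_pmf.emeasure_eq_measure assms ennreal_leI)
  also have "\<dots> = ennreal (measure_pmf.prob (M \<bind> N) S)"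
    by (simp only: emeasure_bind_pmf flip: measure_pmf.emeasure_eq_measure)
  finally show ?thesis
    by simp
qed

lemma prob_Int_ge:
  assumes "1 - d \<le> measure_pmf.prob J A" "1 - e \<le> measure_pmf.prob J B"
  shows "1 - (d + e) \<le> measure_pmf.prob J (A \<inter> B)"
proof -
  have "measure_pmf.prob J (- (A \<inter> B)) \<le> measure_pmf.prob J (- A) + measure_pmf.prob J (- B)"
    unfolding Compl_Int by (rule measure_Un_le) auto
  then show ?thesis
    using assms measure_pmf.prob_compl[of _ J] by (simp add: Compl_eq_Diff_UNIV)
qed

lemma prob_dependent_pair_ge:
  assumes "1 - d \<le> measure_pmf.prob M {a. P a}"
    and "\<And>a. a \<in> set_pmf M \<Longrightarrow> 1 - e \<le> measure_pmf.prob (N a) {b. Q a b}"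
  shows "1 - (d + e) \<le> measure_pmf.prob (M \<bind> (\<lambda>a. map_pmf (Pair a) (N a))) {(a, b). P a \<and> Q a b}"
    (is "_ \<le> measure_pmf.prob ?J _")
proof -
  have "map_pmf fst ?J = M"
    by (simp add: map_bind_pmf map_pmf_comp bind_return_pmf')
  then have "measure_pmf.prob ?J {p. P (fst p)} = measure_pmf.prob M {a. P a}"
    using measure_map_pmf[of fst ?J "{a. P a}"] by (simp add: vimage_def)
  moreover have "1 - e \<le> measure_pmf.prob ?J {(a, b). Q a b}"
    using assms(2) by (intro prob_bind_pmf_ge) (simp add: vimage_def)
  ultimately have "1 - (d + e) \<le> measure_pmf.prob ?J ({p. P (fst p)} \<inter> {(a, b). Q a b})"
    using assms(1) by (intro prob_Int_ge) simp_all
  also have "{p. P (fst p)} \<inter> {(a, b). Q a b} = {(a, b). P a \<and> Q a b}"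
    by auto
  finally show ?thesis .
qed

theorem lemma5p9:
  fixes n m :: "nat \<Rightarrow> nat"
    and PTDF :: ptdf
    and UPO :: upo
    and D :: "nat \<Rightarrow> (bits \<times> bits) pmf"
    and \<C> :: "nat \<Rightarrow> circuit set"
    and pc :: "nat \<Rightarrow> circuit \<Rightarrow> bits \<Rightarrow> bits \<Rightarrow> circuit"
    and InvC :: "nat \<Rightarrow> bits \<Rightarrow> circuit"
  assumes "puncturable_tdf n m PTDF"
    and "inversion_circuits n m PTDF InvC"
    and "unclonable_puncturable_obf m (\<lambda>k. Suc (n k)) (\<lambda>k. enc_opt (n k) None) D \<C> pc UPO"
    and "\<And>k ek td. (ek, td) \<in> set_pmf (kg PTDF k) \<Longrightarrow> InvC k td \<in> \<C> k"
  shows "almost_all_keys_correct n (TDFCP PTDF InvC UPO)"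
proof -
  obtain \<mu> where \<mu>: "negligible \<mu>" and inv: "\<And>k. 1 - \<mu> k \<le> measure_pmf.prob (kg PTDF k)
      {(ek, td). \<forall>x. length x = n k \<longrightarrow> tdf_inv PTDF k td (tdf_eval PTDF k ek x) = Some x}"
    using assms(1) unfolding puncturable_tdf_def inversion_correct_def by blast
  obtain \<nu> \<nu>' where \<nu>: "negligible \<nu>" and \<nu>': "negligible \<nu>'"
    and obf: "\<And>k C. C \<in> \<C> k \<Longrightarrow> 1 - \<nu>' k \<le> measure_pmf.prob (obf UPO k C)
      {p. \<forall>y. length y = m k \<longrightarrow>
        1 - \<nu> k \<le> measure_pmf.prob (upo_eval UPO k p y) {(z, p'). z = circ_eval C y}}"
    using assms(3) unfolding unclonable_puncturable_obf_def upo_correct_def by blast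
  have len: "length (tdf_eval PTDF k ek x) = m k"
    if "(ek, td) \<in> set_pmf (kg PTDF k)" "length x = n k" for k ek td x
    using assms(1) that unfolding puncturable_tdf_def ptdf_syntax_def by fast
  have circ: "circ_eval (InvC k td) y = enc_opt (n k) (tdf_inv PTDF k td y)"
    if "(ek, td) \<in> set_pmf (kg PTDF k)" "length y = m k" for k ek td y
    using assms(2) that unfolding inversion_circuits_def by fast
  have "1 - (\<mu> k + \<nu>' k) \<le> measure_pmf.prob
       (do { (ek, td) \<leftarrow> kg PTDF k; tdh \<leftarrow> obf UPO k (InvC k td); return_pmf (ek, tdh) })
       {(ek, tdh). \<forall>x. length x = n k \<longrightarrow>
          1 - \<nu> k \<le> measure_pmf.prob (upo_eval UPO k tdh (tdf_eval PTDF k ek x))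
            {(z, tdh'). z = enc_opt (n k) (Some x)}}" (is "_ \<le> measure_pmf.prob ?G ?S") for k
  proof -
    \<comment> \<open>The real experiment forgets \<open>td\<close>, but both good events mention
      it. So the argument runs in \<open>J\<close>, which keeps \<open>td\<close>, and is projected
      by \<open>forget_td\<close> at the end.\<close>
    define J where "J = kg PTDF k \<bind> (\<lambda>a. map_pmf (Pair a) (obf UPO k (InvC k (snd a))))"
    define forget_td where "forget_td = (\<lambda>((ek :: bits, td :: bits), tdh :: qstate). (ek, tdh))"
    define P where "P = (\<lambda>(ek, td). \<forall>x. length x = n k \<longrightarrow>
        tdf_inv PTDF k td (tdf_eval PTDF k ek x) = Some x)"
    define Q where "Q = (\<lambda>(ek :: bits, td) p. \<forall>y. length y = m k \<longrightarrow>
        1 - \<nu> k \<le> measure_pmf.prob (upo_eval UPO k p y) {(z, p'). z = circ_eval (InvC k td) y})"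
    have G: "?G = map_pmf forget_td J"
      unfolding J_def forget_td_def
      by (simp add: map_bind_pmf map_pmf_comp case_prod_unfold) (simp add: map_pmf_def)
    have "1 - (\<mu> k + \<nu>' k) \<le> measure_pmf.prob J {(a, p). P a \<and> Q a p}"
      unfolding J_def
    proof (rule prob_dependent_pair_ge)
      show "1 - \<mu> k \<le> measure_pmf.prob (kg PTDF k) {a. P a}"
        using inv[of k] by (simp add: P_def)
      show "1 - \<nu>' k \<le> measure_pmf.prob (obf UPO k (InvC k (snd a))) {p. Q a p}"
        if "a \<in> set_pmf (kg PTDF k)" for a
        using obf[of "InvC k (snd a)" k] assms(4)[of "fst a" "snd a" k] that
        by (simp add: Q_def case_prod_unfold)
    qed
    also have "\<dots> \<le> measure_pmf.prob J (forget_td -` ?S)"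
    \<comment> \<open>The inclusion is claimed only on the support of \<open>J\<close>: output
      lengths and the agreement of \<open>InvC\<close> with \<open>tdf_inv\<close> are guaranteed
      only for key pairs that \<open>kg\<close> can produce.\<close>
    proof (rule measure_pmf.finite_measure_mono_AE)
      show "AE q in measure_pmf J. q \<in> {(a, p). P a \<and> Q a p} \<longrightarrow> q \<in> forget_td -` ?S"
        unfolding AE_measure_pmf_iff
      proof (intro ballI impI)
        fix q
        assume q: "q \<in> set_pmf J" "q \<in> {(a, p). P a \<and> Q a p}"
        obtain ek td p where [simp]: "q = ((ek, td), p)"
          by (metis prod.exhaust)
        have key: "(ek, td) \<in> set_pmf (kg PTDF k)"
          using q(1) by (auto simp: J_def)
        have "1 - \<nu> k \<le> measure_pmf.prob (upo_eval UPO k p (tdf_eval PTDF k ek x))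
            {(z, p'). z = enc_opt (n k) (Some x)}" if x: "length x = n k" for x
        proof -
          \<comment> \<open>\<open>P\<close> makes the trapdoor return \<open>Some x\<close> here,
            so the value that \<open>Q\<close> promises at this point is the encoded
            preimage.\<close>
          have "circ_eval (InvC k td) (tdf_eval PTDF k ek x) = enc_opt (n k) (Some x)"
            using circ[OF key len[OF key x]] q(2) x by (simp add: P_def)
          then show ?thesis
            using q(2) len[OF key x] by (auto simp: Q_def)
        qed
        then show "q \<in> forget_td -` ?S"
          by (simp add: forget_td_def)
      qed
    qed simp
    also have "\<dots> = measure_pmf.prob ?G ?S"
      by (simp only: G measure_map_pmf)
    finally show ?thesis .
  qed
  \<comment> \<open>The inner error is the evaluation error \<open>\<nu>\<close> of the obfuscator,
    unchanged; only the outer error collects both bad events.\<close>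
  then show ?thesis
    using \<nu> negligible_add[OF \<mu> \<nu>']
    unfolding almost_all_keys_correct_def TDFCP_def
    by (intro exI[of _ \<nu>] exI[of _ "\<lambda>k. \<mu> k + \<nu>' k"]) simp
qed

end
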